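(* Let $G$ be a complex unit hypergraph with at least one edge, let $\Delta$ be its maximum vertex degree and $\nabla$ its maximum edge size, and let $\rho(A)$ be the spectral radius of its adjacency matrix $A$. Then $$\rho(A)\le\Delta(\nabla-1),$$ and this inequality is sharp, i.e., there exist complex unit hypergraphs for which equality holds.
   Context: Let $\mathbb T=\{z\in\mathbb C:|z|=1\}$. A complex unit hypergraph $G=(V,E,\mathcal I,\omega)$ consists of finite sets $V=\{v_1,\dots,v_n\}$, $E$, an incidence set $\mathcal I\subseteq V\times E$ (write $v\in e$ if $(v,e)\in\mathcal I$), and $\omega:V\times E\to\mathbb T\cup\{0\}$ with $\omega(v,e)\ne0$ iff $v\in e$. Distinct $v_i,v_j$ are adjacent if some edge contains both, and then for such an edge $\varphi_e(v_i,v_j)=-\omega(v_i,e)\omega(v_j,e)^{-1}$. The degree of a vertex is the number of edges containing it; the size of an edge is the number of vertices it contains. $A=(a_{ij})$ with $a_{ij}=\sum_{e\ni v_i,v_j}\varphi_e(v_i,v_j)$ for $i\ne j$ adjacent (sum over edges containing both), $a_{ij}=0$ otherwise. The spectral radius $\rho(M)$ is the maximum modulus of an eigenvalue of $M$. *)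

theory Defs
  imports "Jordan_Normal_Form.Spectral_Radius"
begin

text \<open>The vertices are given as a list \<open>[v\<^sub>1, \<dots>, v\<^sub>n]\<close> because the adjacency matrix depends on
  their enumeration.  Edges are abstract labels, so distinct edges may have the same vertices.\<close>

record ('v, 'e) hypergraph =
  vertex_list :: "'v list"
  edges :: "'e set"
  incidence :: "('v \<times> 'e) set"
  weight :: "'v \<Rightarrow> 'e \<Rightarrow> complex"

definition vertices :: "('v, 'e) hypergraph \<Rightarrow> 'v set" where
  "vertices G = set (vertex_list G)"

text \<open>There is at least one vertex: the maximum degree, and the spectral radius as a maximum over
  eigenvalues, make no sense otherwise.  Only the values of the weight on
  \<open>vertices G \<times> edges G\<close> matter.\<close>

definition complex_unit_hypergraph :: "('v, 'e) hypergraph \<Rightarrow> bool" where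
  "complex_unit_hypergraph G \<longleftrightarrow>
     distinct (vertex_list G) \<and> vertices G \<noteq> {} \<and> finite (edges G) \<and>
     incidence G \<subseteq> vertices G \<times> edges G \<and>
     (\<forall>v\<in>vertices G. \<forall>e\<in>edges G.
        weight G v e \<in> {z. cmod z = 1} \<union> {0} \<and>
        (weight G v e \<noteq> 0 \<longleftrightarrow> (v, e) \<in> incidence G))"

definition adjacent :: "('v, 'e) hypergraph \<Rightarrow> 'v \<Rightarrow> 'v \<Rightarrow> bool" where
  "adjacent G v w \<longleftrightarrow>
     v \<noteq> w \<and> (\<exists>e\<in>edges G. (v, e) \<in> incidence G \<and> (w, e) \<in> incidence G)"

definition edge_gain :: "('v, 'e) hypergraph \<Rightarrow> 'e \<Rightarrow> 'v \<Rightarrow> 'v \<Rightarrow> complex" where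
  "edge_gain G e v w = - weight G v e * inverse (weight G w e)"

definition vertex_degree :: "('v, 'e) hypergraph \<Rightarrow> 'v \<Rightarrow> nat" where
  "vertex_degree G v = card {e \<in> edges G. (v, e) \<in> incidence G}"

definition edge_size :: "('v, 'e) hypergraph \<Rightarrow> 'e \<Rightarrow> nat" where
  "edge_size G e = card {v \<in> vertices G. (v, e) \<in> incidence G}"

definition max_degree :: "('v, 'e) hypergraph \<Rightarrow> nat" where
  "max_degree G = Max (vertex_degree G ` vertices G)"

definition max_edge_size :: "('v, 'e) hypergraph \<Rightarrow> nat" where
  "max_edge_size G = Max (edge_size G ` edges G)"

definition adjacency_matrix :: "('v, 'e) hypergraph \<Rightarrow> complex mat" where
  "adjacency_matrix G =
     mat (length (vertex_list G)) (length (vertex_list G)) (\<lambda>(i, j).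
       let v = vertex_list G ! i; w = vertex_list G ! j in
       if adjacent G v w
       then \<Sum>e | e \<in> edges G \<and> (v, e) \<in> incidence G \<and> (w, e) \<in> incidence G. edge_gain G e v w
       else 0)"

end

theory Submission
  imports Defs
begin

text \<open>The spectral radius is at most the largest absolute row sum.  In the row of a vertex \<open>v\<close>, every
  edge \<open>e\<close> through \<open>v\<close> contributes an entry of modulus 1 for each of its other vertices, so the
  absolute row sum is at most the sum of \<open>\<bar>e\<bar> - 1\<close> over the edges through \<open>v\<close>.  Equality
  holds when there are \<open>d\<close> parallel edges that all contain all \<open>n\<close> vertices with weight 1: then
  the all-ones vector is an eigenvector with eigenvalue \<open>- d (n - 1)\<close>.\<close>

text \<open>Take an eigenvector for an eigenvalue of largest modulus and read the eigenvalue
  equation at a coordinate where the eigenvector has largest modulus \<open>M\<close>. The triangle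
  inequality bounds the modulus of that eigenvalue times \<open>M\<close> by one absolute row sum
  times \<open>M\<close>.\<close>

lemma spectral_radius_le_row_sums:
  assumes A: "A \<in> carrier_mat n n" and "n > 0"
    and row: "\<And>i. i < n \<Longrightarrow> (\<Sum>j<n. cmod (A $$ (i, j))) \<le> C"
  shows "spectral_radius A \<le> C"
proof -
  obtain k v where ev: "eigenvector A v k" and k: "spectral_radius A = cmod k"
    using spectral_radius_mem_max(1)[OF A \<open>n > 0\<close>]
    by (auto simp: spectrum_def eigenvalue_def)
  from ev A have v: "v \<in> carrier_vec n" "v \<noteq> 0\<^sub>v n" "A *\<^sub>v v = k \<cdot>\<^sub>v v"
    by (auto simp: eigenvector_def)
  define M where "M = Max ((\<lambda>j. cmod (v $ j)) ` {..<n})"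
  have le_M: "cmod (v $ j) \<le> M" if "j < n" for j
    unfolding M_def using that by (intro Max_ge) auto
  have "M \<in> (\<lambda>j. cmod (v $ j)) ` {..<n}"
    unfolding M_def using \<open>n > 0\<close> by (intro Max_in) auto
  then obtain i where i: "i < n" "M = cmod (v $ i)"
    by auto
  \<comment> \<open>A nonzero coordinate makes \<open>M\<close> positive, so that \<open>M\<close>
    can be cancelled at the end.\<close>
  obtain l where l: "l < n" "v $ l \<noteq> 0"
    using v(1,2) by (metis carrier_vecD eq_vecI index_zero_vec)
  have "M > 0"
    using le_M[OF l(1)] l(2) by (smt (verit) zero_less_norm_iff)
  have "k * v $ i = (A *\<^sub>v v) $ i"
    using v i by simp
  also have "\<dots> = (\<Sum>j<n. A $$ (i, j) * v $ j)"
    using A v(1) i by (simp add: scalar_prod_def atLeast0LessThan)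
  finally have "cmod k * M = cmod (\<Sum>j<n. A $$ (i, j) * v $ j)"
    by (metis i(2) norm_mult)
  also have "\<dots> \<le> (\<Sum>j<n. cmod (A $$ (i, j)) * M)"
    by (intro sum_norm_le) (auto simp: norm_mult intro!: mult_left_mono le_M)
  also have "\<dots> = (\<Sum>j<n. cmod (A $$ (i, j))) * M"
    by (simp add: sum_distrib_right)
  also have "\<dots> \<le> C * M"
    using row[OF i(1)] \<open>M > 0\<close> by simp
  finally show ?thesis
    using \<open>M > 0\<close> k by simp
qed

lemma norm_edge_gain:
  assumes "complex_unit_hypergraph G" "e \<in> edges G"
    and "(v, e) \<in> incidence G" "(w, e) \<in> incidence G"
  shows "cmod (edge_gain G e v w) = 1"
proof -
  have "cmod (weight G v e) = 1" "cmod (weight G w e) = 1"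
    using assms unfolding complex_unit_hypergraph_def by blast+
  then show ?thesis
    by (simp add: edge_gain_def norm_mult norm_inverse)
qed

text \<open>All gains have modulus 1, so the entry is bounded by the number of common edges. Writing
  this count as indicators over all edges through \<open>v\<close> makes the index set independent
  of \<open>w\<close>, which allows an interchange of sums along a row.\<close>

lemma norm_adjacency_matrix_le:
  assumes G: "complex_unit_hypergraph G"
    and i: "i < length (vertex_list G)" and j: "j < length (vertex_list G)"
  defines "v \<equiv> vertex_list G ! i" and "w \<equiv> vertex_list G ! j"
  shows "cmod (adjacency_matrix G $$ (i, j)) \<le>
    (\<Sum>e | e \<in> edges G \<and> (v, e) \<in> incidence G. if w \<noteq> v \<and> (w, e) \<in> incidence G then 1 else 0)"
    (is "_ \<le> ?rhs")
proof (cases "adjacent G v w")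
  case True
  have fin: "finite (edges G)"
    using G by (simp add: complex_unit_hypergraph_def)
  let ?S = "{e \<in> edges G. (v, e) \<in> incidence G \<and> (w, e) \<in> incidence G}"
  have "cmod (adjacency_matrix G $$ (i, j)) = cmod (\<Sum>e\<in>?S. edge_gain G e v w)"
    using True i j by (simp add: adjacency_matrix_def v_def w_def Let_def)
  also have "\<dots> \<le> (\<Sum>e\<in>?S. 1)"
    by (intro sum_norm_le) (auto simp: norm_edge_gain[OF G])
  \<comment> \<open>Adjacent vertices are distinct, so here the indicator only tests whether
    \<open>w\<close> lies on \<open>e\<close>.\<close>
  also have "\<dots> = ?rhs"
    using True fin by (intro sum.mono_neutral_cong_left) (auto simp: adjacent_def)
  finally show ?thesis .
next
  case False
  then show ?thesis
    using i j by (simp add: adjacency_matrix_def v_def w_def sum_nonneg)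
qed

text \<open>At most \<open>max_degree G\<close> edges pass through a vertex, and each adds at most
  \<open>max_edge_size G - 1\<close> to the bound on its absolute row sum.\<close>

lemma spectral_radius_adjacency_matrix_le:
  assumes G: "complex_unit_hypergraph G"
  shows "spectral_radius (adjacency_matrix G)
    \<le> real (max_degree G) * (real (max_edge_size G) - 1)"
proof (rule spectral_radius_le_row_sums)
  define n where "n = length (vertex_list G)"
  show "adjacency_matrix G \<in> carrier_mat (length (vertex_list G)) (length (vertex_list G))"
    by (simp add: adjacency_matrix_def)
  show "length (vertex_list G) > 0"
    using G by (auto simp: complex_unit_hypergraph_def vertices_def)
  have dist: "distinct (vertex_list G)" and fin: "finite (edges G)"
    and inc: "incidence G \<subseteq> vertices G \<times> edges G"
    using G by (auto simp: complex_unit_hypergraph_def)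
  have finV: "finite (vertices G)"
    by (simp add: vertices_def)
  have bij: "bij_betw ((!) (vertex_list G)) {..<n} (vertices G)"
    unfolding n_def vertices_def by (rule bij_betw_nth[OF dist]) auto
  have size_le: "edge_size G e \<le> max_edge_size G" if "e \<in> edges G" for e
    unfolding max_edge_size_def using that fin by (intro Max_ge) auto
  fix i assume i: "i < length (vertex_list G)"
  define v where "v = vertex_list G ! i"
  define S where "S = {e \<in> edges G. (v, e) \<in> incidence G}"
  have v: "v \<in> vertices G"
    using i by (simp add: v_def vertices_def)
  have "vertex_degree G v \<le> max_degree G"
    unfolding max_degree_def using v finV by (intro Max_ge) auto
  then have card_S: "card S \<le> max_degree G"
    by (simp add: S_def vertex_degree_def)
  have others: "(\<Sum>w\<in>vertices G. if w \<noteq> v \<and> (w, e) \<in> incidence G then 1 else 0)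
      = real (edge_size G e) - 1" if "e \<in> S" for e
  proof -
    let ?V = "{w \<in> vertices G. (w, e) \<in> incidence G}"
    have mem: "v \<in> ?V"
      using that v by (simp add: S_def)
    \<comment> \<open>This lets the subtraction of naturals below agree with that of reals.\<close>
    then have "edge_size G e \<ge> 1"
      using finV by (auto simp: edge_size_def Suc_le_eq card_gt_0_iff)
    have "(\<Sum>w\<in>vertices G. if w \<noteq> v \<and> (w, e) \<in> incidence G then 1 else 0) = (\<Sum>w\<in>?V - {v}. 1::real)"
      using finV by (intro sum.mono_neutral_cong_right) auto
    also have "\<dots> = real (card ?V - 1)"
      using mem finV by (simp add: card_Diff_singleton)
    also have "\<dots> = real (edge_size G e) - 1"
      using \<open>edge_size G e \<ge> 1\<close> by (simp add: edge_size_def of_nat_diff)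
    finally show ?thesis .
  qed
  have "(\<Sum>j<n. cmod (adjacency_matrix G $$ (i, j)))
      \<le> (\<Sum>j<n. \<Sum>e\<in>S. if vertex_list G ! j \<noteq> v \<and> (vertex_list G ! j, e) \<in> incidence G then 1 else 0)"
    using norm_adjacency_matrix_le[OF G i] by (intro sum_mono) (auto simp: n_def v_def S_def)
  also have "\<dots> = (\<Sum>w\<in>vertices G. \<Sum>e\<in>S. if w \<noteq> v \<and> (w, e) \<in> incidence G then 1 else 0)"
    by (rule sum.reindex_bij_betw[OF bij])
  \<comment> \<open>Double counting of the pairs of an edge \<open>e\<close> through
    \<open>v\<close> and a vertex \<open>w\<close> on \<open>e\<close> other than
    \<open>v\<close>.\<close>
  also have "\<dots> = (\<Sum>e\<in>S. \<Sum>w\<in>vertices G. if w \<noteq> v \<and> (w, e) \<in> incidence G then 1 else 0)"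
    by (rule sum.swap)
  also have "\<dots> = (\<Sum>e\<in>S. real (edge_size G e) - 1)"
    by (intro sum.cong refl others)
  also have "\<dots> \<le> (\<Sum>e\<in>S. real (max_edge_size G) - 1)"
    by (intro sum_mono) (auto simp: S_def size_le)
  also have "\<dots> = real (card S) * (real (max_edge_size G) - 1)"
    by simp
  also have "\<dots> \<le> real (max_degree G) * (real (max_edge_size G) - 1)"
  proof (cases "max_edge_size G \<ge> 1")
    case True
    then show ?thesis
      using card_S by (intro mult_right_mono) auto
  next
    \<comment> \<open>Monotonicity fails here, since the second factor is -1.\<close>
    case False
    \<comment> \<open>With maximum size 0 every edge is empty, so there are no incidences and both
      products vanish.\<close>
    have no_inc: "incidence G = {}"
    proof -
      have "edge_size G e = 0" if "e \<in> edges G" for e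
        using size_le[OF that] False by simp
      then show ?thesis
        using inc finV by (fastforce simp: edge_size_def)
    qed
    then have "max_degree G = 0"
      using v by (auto simp: max_degree_def vertex_degree_def image_constant_conv)
    moreover have "S = {}"
      using no_inc by (simp add: S_def)
    ultimately show ?thesis
      by simp
  qed
  finally show "(\<Sum>j<length (vertex_list G). cmod (adjacency_matrix G $$ (i, j)))
      \<le> real (max_degree G) * (real (max_edge_size G) - 1)"
    by (simp add: n_def)
qed

text \<open>For positive \<open>n\<close> and \<open>d\<close> the adjacency matrix is
  \<open>-d\<close> times that of the complete graph on \<open>n\<close> vertices.\<close>

definition full_hypergraph :: "nat \<Rightarrow> nat \<Rightarrow> (nat, nat) hypergraph" where
  "full_hypergraph n d =
     \<lparr>vertex_list = [0..<n], edges = {..<d}, incidence = {..<n} \<times> {..<d}, weight = (\<lambda>_ _. 1)\<rparr>"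

context
  fixes n d :: nat
  assumes n: "n > 0" and d: "d > 0"
begin

lemma complex_unit_hypergraph_full: "complex_unit_hypergraph (full_hypergraph n d)"
  using n by (auto simp: complex_unit_hypergraph_def vertices_def full_hypergraph_def)

lemma max_degree_full: "max_degree (full_hypergraph n d) = d"
proof -
  have "vertex_degree (full_hypergraph n d) v = d" if "v < n" for v
    using that by (simp add: vertex_degree_def full_hypergraph_def lessThan_def[symmetric])
  then have "vertex_degree (full_hypergraph n d) ` {..<n} = {d}"
    using n by force
  then show ?thesis
    by (simp add: max_degree_def vertices_def full_hypergraph_def atLeast0LessThan)
qed

lemma max_edge_size_full: "max_edge_size (full_hypergraph n d) = n"
proof -
  have "edge_size (full_hypergraph n d) e = n" if "e < d" for e
    using that by (simp add: edge_size_def vertices_def full_hypergraph_def lessThan_def[symmetric])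
  then have "edge_size (full_hypergraph n d) ` {..<d} = {n}"
    using d by force
  then show ?thesis
    by (simp add: max_edge_size_def full_hypergraph_def)
qed

text \<open>The upper bound is the general inequality; the explicit eigenvector serves for the lower
  bound.\<close>

lemma spectral_radius_adjacency_matrix_full:
  "spectral_radius (adjacency_matrix (full_hypergraph n d)) = real d * (real n - 1)"
proof (rule antisym)
  let ?A = "adjacency_matrix (full_hypergraph n d)"
  show "spectral_radius ?A \<le> real d * (real n - 1)"
    using spectral_radius_adjacency_matrix_le[OF complex_unit_hypergraph_full]
    unfolding max_degree_full max_edge_size_full .
  have A: "?A \<in> carrier_mat n n"
    by (simp add: adjacency_matrix_def full_hypergraph_def)
  \<comment> \<open>Distinct vertices share all \<open>d\<close> edges, and each shared edge has
    gain -1.\<close>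
  have entry: "?A $$ (i, j) = (if i = j then 0 else - of_nat d)" if "i < n" "j < n" for i j
    using that d
    by (auto simp: adjacency_matrix_def full_hypergraph_def adjacent_def edge_gain_def
        lessThan_def[symmetric])
  let ?v = "vec n (\<lambda>_. 1) :: complex vec" and ?c = "- of_nat d * (of_nat n - 1) :: complex"
  have "?A *\<^sub>v ?v = ?c \<cdot>\<^sub>v ?v"
  proof (rule eq_vecI)
    fix i assume "i < dim_vec (?c \<cdot>\<^sub>v ?v)"
    then have i: "i < n"
      by simp
    then have "(?A *\<^sub>v ?v) $ i = (\<Sum>j<n. ?A $$ (i, j))"
      using A by (simp add: scalar_prod_def atLeast0LessThan)
    \<comment> \<open>Dropping the zero diagonal entry leaves \<open>n - 1\<close> equal
      terms.\<close>
    also have "\<dots> = (\<Sum>j\<in>{..<n} - {i}. - of_nat d)"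
      using i by (intro sum.mono_neutral_cong_right) (auto simp: entry)
    also have "\<dots> = ?c"
      using i n by (simp add: of_nat_diff)
    finally show "(?A *\<^sub>v ?v) $ i = (?c \<cdot>\<^sub>v ?v) $ i"
      using i by simp
  qed (use A in auto)
  moreover have "?v \<noteq> 0\<^sub>v n"
    using n by (metis index_vec index_zero_vec(1) zero_neq_one)
  ultimately have "eigenvalue ?A ?c"
    using A by (auto simp: eigenvalue_def eigenvector_def intro!: exI[of _ ?v])
  then have "cmod ?c \<le> spectral_radius ?A"
    using n by (intro spectral_radius_mem_max(2)[OF A] imageI) (simp_all add: spectrum_def)
  \<comment> \<open>Since \<open>n\<close> is positive, \<open>of_nat n - 1\<close> is the image of
    the natural number \<open>n - 1\<close>.\<close>
  moreover have "cmod (of_nat n - 1) = real n - 1"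
    using n by (metis One_nat_def Suc_leI norm_of_nat of_nat_1 of_nat_diff)
  ultimately show "real d * (real n - 1) \<le> spectral_radius ?A"
    by (simp add: norm_mult)
qed

end

theorem theorem5p7:
  shows "(\<forall>G :: ('v, 'e) hypergraph.
            complex_unit_hypergraph G \<and> edges G \<noteq> {} \<longrightarrow>
            spectral_radius (adjacency_matrix G)
              \<le> real (max_degree G) * (real (max_edge_size G) - 1)) \<and>
         (\<exists>H :: (nat, nat) hypergraph.
            complex_unit_hypergraph H \<and> edges H \<noteq> {} \<and>
            spectral_radius (adjacency_matrix H)
              = real (max_degree H) * (real (max_edge_size H) - 1))"
\<comment> \<open>Three vertices and two parallel edges make both sides 4, so equality is attained
  at a nonzero value.\<close>
proof (intro conjI allI impI exI[of _ "full_hypergraph 3 2"])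
  show "edges (full_hypergraph 3 2) \<noteq> {}"
    by (simp add: full_hypergraph_def lessThan_empty_iff)
qed (auto simp: spectral_radius_adjacency_matrix_le complex_unit_hypergraph_full
    max_degree_full max_edge_size_full spectral_radius_adjacency_matrix_full)

end
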